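(* Let $X$ be a hermetic metric space and $A\subseteq X$. Then the following conditions are equivalent: (i) $A$ is a closed set which does not contain isolated points of $X$; (ii) there exists a continuous function $f\colon X\to\mathbb{R}$ such that $\ell^{\infty}(f)=\mathbb{L}^{\infty}(f)=L^{\infty}(f)=A$.
   Context: Let $X$ be a metric space with metric $|\cdot-\cdot|_X$ and open balls $B(x,r)$; $X^d$ is the set of non-isolated points of $X$. Convention: $\sup\varnothing=0$. Lipschitz derivatives. For $f\colon X\to\mathbb{R}$, $x\in X$, $r>0$ let $\operatorname{Lip}^rf(x)=\frac1r\sup_{u\in B(x,r)}|f(x)-f(u)|$. Then the big Lipschitz derivative is $\operatorname{Lip}f(x)=\limsup_{r\to0^+}\operatorname{Lip}^rf(x)$; the little Lipschitz derivative is $\operatorname{lip}f(x)=\liminf_{r\to0^+}\operatorname{Lip}^rf(x)$; the local Lipschitz derivative is $\mathbb{L}\mathrm{ip}f(x)=\inf_{r>0}\ \sup_{u,v\in B(x,r),\,u\ne v}\frac{|f(u)-f(v)|}{|u-v|_X}$. All are $0$ at isolated points of $X$. Put $L^\infty(f)=\{x:\operatorname{Lip}f(x)=\infty\}$, $\ell^\infty(f)=\{x:\operatorname{lip}f(x)=\infty\}$, $\mathbb{L}^\infty(f)=\{x:\mathbb{L}\mathrm{ip}f(x)=\infty\}$. Hermeticity. For $x\in X^d$, $H(X,x)=\liminf_{r\to0^+}\frac1r\sup_{u\in B(x,r)}|u-x|_X$, and $H(X)=\inf_{x\in X^d}H(X,x)$ (the infimum over the empty set being $+\infty$). The space $X$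 is hermetic if $H(X)>0$. "Isolated points of $X$" means points isolated in the whole space $X$ (not in the subspace $A$). *)

theory Defs
  imports "HOL-Analysis.Analysis"
begin

text \<open>
  All suprema and infima are taken in \<^typ>\<open>ennreal\<close>. There the supremum of the empty set is
  \<open>0\<close> and the infimum of the empty set is \<open>\<infinity>\<close>, which are the conventions used here. In
  particular, the three Lipschitz derivatives vanish at isolated points without a case
  distinction: small balls around such a point are singletons.
\<close>

definition Lip_scale :: "real \<Rightarrow> ('a::metric_space \<Rightarrow> real) \<Rightarrow> 'a \<Rightarrow> ennreal" where
  "Lip_scale r f x = ennreal (1 / r) * (SUP u\<in>ball x r. ennreal \<bar>f x - f u\<bar>)"

definition big_Lip :: "('a::metric_space \<Rightarrow> real) \<Rightarrow> 'a \<Rightarrow> ennreal" where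
  "big_Lip f x = Limsup (at_right 0) (\<lambda>r. Lip_scale r f x)"

definition little_lip :: "('a::metric_space \<Rightarrow> real) \<Rightarrow> 'a \<Rightarrow> ennreal" where
  "little_lip f x = Liminf (at_right 0) (\<lambda>r. Lip_scale r f x)"

definition local_Lip :: "('a::metric_space \<Rightarrow> real) \<Rightarrow> 'a \<Rightarrow> ennreal" where
  "local_Lip f x =
     (INF r\<in>{0<..}. SUP (u, v)\<in>{(u, v). u \<in> ball x r \<and> v \<in> ball x r \<and> u \<noteq> v}.
        ennreal (\<bar>f u - f v\<bar> / dist u v))"

definition big_Lip_inf :: "('a::metric_space \<Rightarrow> real) \<Rightarrow> 'a set" where
  "big_Lip_inf f = {x. big_Lip f x = \<infinity>}"

definition little_lip_inf :: "('a::metric_space \<Rightarrow> real) \<Rightarrow> 'a set" where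
  "little_lip_inf f = {x. little_lip f x = \<infinity>}"

definition local_Lip_inf :: "('a::metric_space \<Rightarrow> real) \<Rightarrow> 'a set" where
  "local_Lip_inf f = {x. local_Lip f x = \<infinity>}"

definition hermeticity_at :: "'a::metric_space \<Rightarrow> ennreal" where
  "hermeticity_at x =
     Liminf (at_right 0) (\<lambda>r. ennreal (1 / r) * (SUP u\<in>ball x r. ennreal (dist u x)))"

definition hermeticity :: "'a::metric_space itself \<Rightarrow> ennreal" where
  "hermeticity _ = (INF x\<in>{x::'a. \<not> x isolated_in UNIV}. hermeticity_at x)"

definition hermetic :: "'a::metric_space itself \<Rightarrow> bool" where
  "hermetic T \<longleftrightarrow> hermeticity T > 0"

end

theory Submission
  imports Defs
begin

text \<open>
  For the existence of \<open>f\<close> the idea is a lacunary series of tents, as in the classical nowhere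
  differentiable functions. Fix a small ratio \<open>q\<close> and, for each \<open>n\<close>, a maximal subset \<open>D n\<close> of
  \<open>A\<close> whose points are at least \<open>q ^ (2 * n)\<close> apart. Put a tent of height \<open>q ^ n\<close> and radius
  \<open>q ^ (2 * n)\<close> on every point of \<open>D n\<close>, and let \<open>f\<close> be the sum of all these layers. The heights are
  summable, so \<open>f\<close> is continuous.

  Near a point \<open>x\<close> of \<open>A\<close>, the \<open>n\<close>-th layer varies by a fixed fraction of its height within
  distance \<open>q ^ (2 * n)\<close> of \<open>x\<close> (lemma \<open>tent_oscillation\<close>): by maximality a tip is near, and if
  \<open>x\<close> itself is almost a tip, then hermeticity supplies a point at a comparable distance from \<open>x\<close>,
  hence from all tips. The earlier layers have slopes up to \<open>1 / q ^ k\<close> with \<open>k < n\<close> and the later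
  ones have heights \<open>q ^ k\<close> with \<open>k > n\<close>; both contributions are geometric and too small to cancel
  this variation (lemma \<open>lacunary_sum_increment\<close>). So \<open>f\<close> varies by about \<open>q ^ n\<close> at all scales
  between \<open>q ^ (2 * n)\<close> and \<open>q ^ (2 * n - 2)\<close>, which makes the quotient of
  the oscillation of \<open>f\<close> by the radius at least of the order of \<open>1 / q ^ n\<close> for all small radii, as
  an infinite lower limit demands, and not only along a sequence of radii. Away from the
  closed set \<open>A\<close> only finitely many layers are nonzero, so \<open>f\<close> is locally Lipschitz there. Since the
  little derivative is at most the big one, which is at most the local one, all three sets are \<open>A\<close>.

  Conversely, the local Lipschitz derivative is bounded near every point where it is finite, and it
  vanishes at isolated points.
\<close>

section \<open>Comparison of the Lipschitz derivatives\<close>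

lemma little_lip_le_big_Lip: "little_lip f x \<le> big_Lip f x"
  unfolding little_lip_def big_Lip_def by (rule Liminf_le_Limsup) simp

text \<open>A point \<open>u\<close> of the ball of radius \<open>s\<close> has \<open>dist x u < s\<close>, so the slope between \<open>x\<close> and \<open>u\<close> is
  at least the increment divided by \<open>s\<close>.\<close>

lemma big_Lip_le_local_Lip: "big_Lip f x \<le> local_Lip f x"
  unfolding local_Lip_def
proof (rule INF_greatest)
  fix r :: real
  assume "r \<in> {0<..}"
  hence r: "0 < r" by simp
  let ?Q = "SUP (u, v)\<in>{(u, v). u \<in> ball x r \<and> v \<in> ball x r \<and> u \<noteq> v}.
    ennreal (\<bar>f u - f v\<bar> / dist u v)"
  have "Lip_scale s f x \<le> ?Q" if s: "0 < s" "s < r" for s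
  proof -
    have "ennreal (1 / s) * ennreal \<bar>f x - f u\<bar> \<le> ?Q" if u: "u \<in> ball x s" for u
    proof (cases "u = x")
      case False
      have "ennreal (1 / s) * ennreal \<bar>f x - f u\<bar> = ennreal (\<bar>f x - f u\<bar> / s)"
        using s by (simp add: ennreal_mult' [symmetric])
      also have "\<dots> \<le> ennreal (\<bar>f x - f u\<bar> / dist x u)"
        using u False s by (intro ennreal_leI divide_left_mono) auto
      also have "\<dots> \<le> ?Q"
        using u False s r by (intro SUP_upper2 [where i = "(x, u)"]) auto
      finally show ?thesis .
    qed simp
    thus ?thesis
      unfolding Lip_scale_def by (subst SUP_mult_left_ennreal) (rule SUP_least)
  qed
  hence "eventually (\<lambda>s. Lip_scale s f x \<le> ?Q) (at_right 0)"
    using r by (auto simp: eventually_at_right_field)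
  thus "big_Lip f x \<le> ?Q"
    unfolding big_Lip_def by (rule Limsup_bounded)
qed

lemma local_Lip_finite_if_lipschitz_near:
  assumes "0 < r" and "\<And>u v. u \<in> ball x r \<Longrightarrow> v \<in> ball x r \<Longrightarrow> \<bar>f u - f v\<bar> \<le> K * dist u v"
  shows "local_Lip f x < \<infinity>"
proof -
  have "local_Lip f x \<le> ennreal K"
    unfolding local_Lip_def
    using assms by (intro INF_lower2 [of r] SUP_least) (auto intro!: ennreal_leI simp: divide_le_eq)
  thus ?thesis
    using ennreal_less_top le_less_trans by (metis infinity_ennreal_def)
qed

lemma closed_local_Lip_inf: "closed (local_Lip_inf f)"
proof -
  have "\<exists>r>0. ball x r \<subseteq> - local_Lip_inf f" if "x \<in> - local_Lip_inf f" for x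
  proof -
    let ?Q = "\<lambda>x r. SUP (u, v)\<in>{(u, v). u \<in> ball x r \<and> v \<in> ball x r \<and> u \<noteq> v}.
      ennreal (\<bar>f u - f v\<bar> / dist u v)"
    have "local_Lip f x < \<infinity>"
      using that by (simp add: local_Lip_inf_def top.not_eq_extremum)
    then obtain r where r: "0 < r" "?Q x r < \<infinity>"
      unfolding local_Lip_def INF_less_iff by auto
    have "local_Lip f y < \<infinity>" if y: "y \<in> ball x r" for y
    proof -
      have sub: "ball y (r - dist x y) \<subseteq> ball x r"
        using dist_triangle [of x _ y] by (fastforce simp: less_diff_eq intro: le_less_trans)
      have "local_Lip f y \<le> ?Q y (r - dist x y)"
        unfolding local_Lip_def using y by (intro INF_lower) auto
      also have "\<dots> \<le> ?Q x r"
        using sub by (intro SUP_subset_mono) auto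
      finally show ?thesis using r by simp
    qed
    hence "ball x r \<subseteq> - local_Lip_inf f"
      by (force simp: local_Lip_inf_def)
    thus ?thesis using r by blast
  qed
  hence "open (- local_Lip_inf f)" by (simp add: open_contains_ball)
  thus ?thesis by (simp add: closed_def)
qed

lemma local_Lip_isolated:
  assumes "x isolated_in UNIV"
  shows "local_Lip f x < \<infinity>"
proof -
  obtain e where e: "e > 0" "\<And>y. dist x y < e \<Longrightarrow> y = x"
    using assms by (auto simp: isolated_in_dist_Ex_iff)
  show ?thesis
  proof (rule local_Lip_finite_if_lipschitz_near [of e x f 0])
    fix u v assume "u \<in> ball x e" "v \<in> ball x e"
    hence "u = x" "v = x" using e by auto
    thus "\<bar>f u - f v\<bar> \<le> 0 * dist u v" by simp
  qed (rule e)
qed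

section \<open>Hermeticity and separated sets\<close>

text \<open>One constant serves all non-isolated points, but the range of admissible scales depends on the
  point. The bound by \<open>1\<close> is only a normalisation.\<close>

lemma hermetic_uniform_constant:
  assumes "hermetic TYPE('a::metric_space)"
  obtains c :: real where "0 < c" "c \<le> 1"
    and "\<And>x::'a. \<not> x isolated_in UNIV \<Longrightarrow>
           eventually (\<lambda>r. \<exists>u. c * r < dist u x \<and> dist u x < r) (at_right 0)"
proof -
  have "0 < min 1 (hermeticity TYPE('a))"
    using assms by (simp add: hermetic_def)
  then obtain b where b: "0 < b" "b < min 1 (hermeticity TYPE('a))"
    using dense by blast
  then obtain c where c: "b = ennreal c" "0 \<le> c"
    by (cases b) auto
  show thesis
  proof (rule that)
    show "0 < c" "c \<le> 1" using b c by (auto simp: ennreal_less_iff)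
    fix x :: 'a
    assume "\<not> x isolated_in UNIV"
    hence "b < hermeticity_at x"
      using b unfolding hermeticity_def by (auto intro: less_le_trans INF_lower)
    hence "eventually (\<lambda>r. b < ennreal (1 / r) * (SUP u\<in>ball x r. ennreal (dist u x))) (at_right 0)"
      unfolding hermeticity_at_def by (rule less_LiminfD)
    moreover have "eventually (\<lambda>r::real. 0 < r) (at_right 0)"
      by (simp add: eventually_at_right_less)
    ultimately show "eventually (\<lambda>r. \<exists>u. c * r < dist u x \<and> dist u x < r) (at_right 0)"
    proof eventually_elim
      case (elim r)
      then obtain u where u: "u \<in> ball x r" "b < ennreal (1 / r) * ennreal (dist u x)"
        by (auto simp: SUP_mult_left_ennreal less_SUP_iff)
      hence "c < 1 / r * dist u x"
        using elim c by (simp add: ennreal_mult' [symmetric] ennreal_less_iff)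
      thus ?case
        using u elim by (intro exI [of _ u]) (auto simp: field_simps dist_commute)
    qed
  qed
qed

lemma maximal_separated_subset:
  fixes A :: "'a::metric_space set"
  assumes "0 < e"
  obtains D where "D \<subseteq> A" "pairwise (\<lambda>p q. e \<le> dist p q) D" "\<And>x. x \<in> A \<Longrightarrow> \<exists>p\<in>D. dist x p < e"
proof -
  let ?S = "{D. D \<subseteq> A \<and> pairwise (\<lambda>p q. e \<le> dist p q) D}"
  have "\<exists>M\<in>?S. \<forall>X\<in>?S. M \<subseteq> X \<longrightarrow> X = M"
  proof (rule subset_Zorn')
    fix C assume "subset.chain ?S C"
    hence "C \<subseteq> ?S" "chain\<^sub>\<subseteq> C"
      by (auto simp: subset_chain_def chain_subset_def)
    thus "\<Union>C \<in> ?S"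
      using pairwise_chain_Union [of C] by auto
  qed
  then obtain D where D: "D \<subseteq> A" "pairwise (\<lambda>p q. e \<le> dist p q) D"
    and max: "\<And>X. X \<subseteq> A \<Longrightarrow> pairwise (\<lambda>p q. e \<le> dist p q) X \<Longrightarrow> D \<subseteq> X \<Longrightarrow> X = D"
    by auto
  have "\<exists>p\<in>D. dist x p < e" if "x \<in> A" for x
  proof (rule ccontr)
    assume far: "\<not> (\<exists>p\<in>D. dist x p < e)"
    hence "pairwise (\<lambda>p q. e \<le> dist p q) (insert x D)"
      using D by (auto simp: pairwise_insert dist_commute not_less)
    hence "x \<in> D" using max [of "insert x D"] D that by auto
    thus False using far assms by auto
  qed
  thus thesis using D that by blast
qed

section \<open>Tents\<close>

definition tent :: "'a::metric_space set \<Rightarrow> real \<Rightarrow> 'a \<Rightarrow> real" where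
  "tent D e x = max 0 (1 - infdist x D / e)"

lemma tent_nonneg: "0 \<le> tent D e x"
  by (simp add: tent_def)

lemma tent_le_1: "0 < e \<Longrightarrow> tent D e x \<le> 1"
  by (simp add: tent_def infdist_nonneg)

lemma tent_increment_le_1: "0 < e \<Longrightarrow> \<bar>tent D e x - tent D e y\<bar> \<le> 1"
  using tent_nonneg [of D e x] tent_nonneg [of D e y] tent_le_1 [of e D x] tent_le_1 [of e D y]
  by linarith

lemma tent_lipschitz:
  assumes "0 < e"
  shows "\<bar>tent D e x - tent D e y\<bar> \<le> dist x y / e"
proof -
  have "\<bar>tent D e x - tent D e y\<bar> \<le> \<bar>infdist x D / e - infdist y D / e\<bar>"
    by (auto simp: tent_def max_def)
  also have "\<dots> = \<bar>infdist x D - infdist y D\<bar> / e"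
    using assms by (simp add: diff_divide_distrib [symmetric])
  finally show ?thesis
    using assms infdist_triangle_abs [of x D y] by (meson divide_right_mono less_imp_le order_trans)
qed

lemma continuous_on_tent: "continuous_on S (tent D e)"
  unfolding tent_def [abs_def] divide_inverse by (intro continuous_intros)

text \<open>If \<open>x\<close> is far from all tips, comparing it with the tip \<open>p\<close> suffices. If \<open>x\<close> is nearly a tip,
  the point \<open>u\<close> is far from the tip next to \<open>x\<close> because it is far from \<open>x\<close>, and far from the other
  tips because its distance from \<open>x\<close> is less than half the separation distance.\<close>

lemma tent_oscillation:
  assumes e: "0 < e" and c: "0 < c" "c \<le> 1"
    and sep: "pairwise (\<lambda>p q. e \<le> dist p q) D"
    and p: "p \<in> D" "dist x p < e"
    and u: "c * (e / 2) < dist u x" "dist u x < e / 2"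
  shows "\<exists>v. dist v x < e \<and> c / 8 \<le> \<bar>tent D e v - tent D e x\<bar>"
proof (cases "c * e / 8 \<le> infdist x D")
  case True
  have "c / 8 \<le> infdist x D / e" using True e by (simp add: field_simps)
  moreover have "tent D e p = 1" using p by (simp add: tent_def)
  moreover have "tent D e x = max 0 (1 - infdist x D / e)" by (simp only: tent_def)
  ultimately have "c / 8 \<le> \<bar>tent D e p - tent D e x\<bar>"
    using c by linarith
  thus ?thesis using p by (metis dist_commute)
next
  case False
  have D: "D \<noteq> {}" using p by auto
  have "\<exists>a\<in>D. dist x a < c * e / 8"
    using False cINF_less_iff [OF D, of "dist x" "c * e / 8"] D
    by (auto simp: infdist_notempty not_le)
  then obtain a where a: "a \<in> D" "dist x a < c * e / 8" by blast
  have ce: "c * e \<le> e" using c e by simp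
  have far: "c * e / 4 \<le> dist u b" if b: "b \<in> D" for b
  proof (cases "b = a")
    case True
    have "dist u x \<le> dist u a + dist x a" by (metis dist_triangle2)
    thus ?thesis using True a u c e mult_pos_pos [OF c(1) e] by auto
  next
    case False
    have "e \<le> dist a b" using sep a b False by (auto simp: pairwise_def)
    also have "\<dots> \<le> dist x a + dist u x + dist u b"
      by (smt (verit) dist_commute dist_triangle)
    finally show ?thesis using a u ce e by linarith
  qed
  have "c * e / 4 \<le> infdist u D"
    unfolding infdist_notempty [OF D] by (rule cINF_greatest [OF D far])
  hence "c / 4 \<le> infdist u D / e" using e by (simp add: field_simps)
  moreover have "infdist x D / e \<le> c / 8" using False e by (simp add: field_simps)
  moreover have "tent D e u = max 0 (1 - infdist u D / e)" "tent D e x = max 0 (1 - infdist x D / e)"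
    by (simp_all only: tent_def)
  ultimately have "c / 8 \<le> \<bar>tent D e u - tent D e x\<bar>"
    using c by linarith
  thus ?thesis using u e by (intro exI [of _ u]) auto
qed

section \<open>Lacunary series\<close>

text \<open>The increments of the layers other than the \<open>n\<close>-th decay geometrically in both directions away
  from \<open>n\<close>: upwards because the heights decay, and downwards because \<open>q ^ k / q ^ (2 * k)\<close>, the
  slope of layer \<open>k\<close>, times the distance \<open>q ^ (2 * n)\<close> is \<open>q ^ n * q ^ (n - k)\<close>. Each direction
  contributes at most \<open>q ^ n * (q / (1 - q))\<close>.\<close>

lemma lacunary_sum_increment:
  fixes d :: "nat \<Rightarrow> real"
  assumes q: "0 < q" "q < 1"
    and up: "\<And>k. \<bar>d k\<bar> \<le> 1" and down: "\<And>k. \<bar>d k\<bar> \<le> q ^ (2 * n) / q ^ (2 * k)"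
  shows "(\<bar>d n\<bar> - 2 * (q / (1 - q))) * q ^ n \<le> \<bar>\<Sum>k. q ^ k * d k\<bar>"
proof -
  let ?t = "\<lambda>k. q ^ k * d k"
  have geo: "(\<lambda>j. q ^ n * q ^ Suc j) sums (q ^ n * (q / (1 - q)))"
    using sums_mult [OF geometric_sums [of q], of "q ^ n * q"] q by (simp add: algebra_simps)
  have tle: "\<bar>?t k\<bar> \<le> q ^ k" for k
    using up [of k] q by (simp add: abs_mult mult_left_le)
  have summ: "summable ?t"
    by (rule summable_comparison_test' [of "\<lambda>k. q ^ k" 0]) (use q tle in auto)
  have split: "suminf ?t = (\<Sum>k<n. ?t k) + ?t n + (\<Sum>k. ?t (k + Suc n))"
    using suminf_split_initial_segment [OF summ, of "Suc n"] by simp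
  have "\<bar>\<Sum>k<n. ?t k\<bar> \<le> (\<Sum>k<n. q ^ n * q ^ (n - k))"
  proof (rule order_trans [OF sum_abs sum_mono])
    fix k assume "k \<in> {..<n}"
    then obtain m where m: "n = k + m" using less_imp_add_positive by blast
    have "\<bar>?t k\<bar> \<le> q ^ k * (q ^ (2 * n) / q ^ (2 * k))"
      using mult_left_mono [OF down [of k], of "q ^ k"] q by (simp add: abs_mult)
    also have "\<dots> = q ^ n * q ^ (n - k)"
      using q by (simp add: m field_simps power_add mult_2_right)
    finally show "\<bar>?t k\<bar> \<le> q ^ n * q ^ (n - k)" .
  qed
  also have "\<dots> = (\<Sum>j<n. q ^ n * q ^ Suc j)"
    by (subst sum.nat_diff_reindex [symmetric]) (auto intro!: sum.cong simp: Suc_diff_Suc)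
  also have "\<dots> \<le> q ^ n * (q / (1 - q))"
    using sum_le_suminf [OF sums_summable [OF geo], of "{..<n}"] sums_unique [OF geo] q by auto
  finally have head: "\<bar>\<Sum>k<n. ?t k\<bar> \<le> q ^ n * (q / (1 - q))" .
  have "norm (\<Sum>k. ?t (k + Suc n)) \<le> (\<Sum>j. q ^ n * q ^ Suc j)"
    using tle [of "_ + Suc n"]
    by (intro norm_suminf_le sums_summable [OF geo]) (auto simp: power_add mult_ac)
  hence tail: "\<bar>\<Sum>k. ?t (k + Suc n)\<bar> \<le> q ^ n * (q / (1 - q))"
    using sums_unique [OF geo] by simp
  have "\<bar>?t n\<bar> = \<bar>d n\<bar> * q ^ n" using q by (simp add: abs_mult)
  moreover have "(\<bar>d n\<bar> - 2 * (q / (1 - q))) * q ^ n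
      = \<bar>d n\<bar> * q ^ n - q ^ n * (q / (1 - q)) - q ^ n * (q / (1 - q))"
    by (simp add: algebra_simps)
  moreover have "\<bar>b\<bar> - e - e \<le> \<bar>a + b + b'\<bar>" if "\<bar>a\<bar> \<le> e" "\<bar>b'\<bar> \<le> e" for a b b' e :: real
    using that by linarith
  from this [OF head tail, of "?t n"]
  have "\<bar>?t n\<bar> - q ^ n * (q / (1 - q)) - q ^ n * (q / (1 - q)) \<le> \<bar>suminf ?t\<bar>"
    by (simp only: split)
  ultimately show ?thesis by simp
qed

text \<open>Consecutive distances \<open>q ^ (2 * n)\<close> differ by the bounded factor \<open>q\<^sup>2\<close>, so every small radius \<open>r\<close> is
  comparable with one of them, at which the increment exceeds \<open>r\<close> by a factor of order \<open>1 / q ^ n\<close>.\<close>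

lemma little_lip_infinite_if_increments:
  fixes f :: "'a::metric_space \<Rightarrow> real"
  assumes q: "0 < q" "q < 1" and C: "0 < C"
    and incr: "\<And>n. N \<le> n \<Longrightarrow> \<exists>u. dist u x < q ^ (2 * n) \<and> C * q ^ n \<le> \<bar>f u - f x\<bar>"
  shows "little_lip f x = \<infinity>"
proof -
  have "ennreal (real m) \<le> little_lip f x" for m
  proof -
    have "((\<lambda>n. q ^ n) \<longlongrightarrow> 0) sequentially" using q by (intro LIMSEQ_realpow_zero) auto
    moreover have "0 < C * q\<^sup>2 / (real m + 1)" using q C by simp
    ultimately have "eventually (\<lambda>n. q ^ n < C * q\<^sup>2 / (real m + 1)) sequentially"
      by (rule order_tendstoD)
    then obtain N1 where N1: "\<And>n. N1 \<le> n \<Longrightarrow> q ^ n < C * q\<^sup>2 / (real m + 1)"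
      by (auto simp: eventually_sequentially)
    let ?K = "max N N1"
    have "ennreal (real m) \<le> Lip_scale r f x" if r: "0 < r" "r < q ^ (2 * ?K)" for r
    proof -
      have "\<exists>n. q ^ (2 * n) \<le> r"
      proof -
        have "q\<^sup>2 < 1" using q by (simp add: power_less_one_iff)
        then obtain n where "(q\<^sup>2) ^ n < r" using real_arch_pow_inv r by blast
        thus ?thesis by (auto simp: power_mult intro: less_imp_le)
      qed
      define n where "n = (LEAST n. q ^ (2 * n) \<le> r)"
      have n: "q ^ (2 * n) \<le> r" unfolding n_def using \<open>\<exists>n. _\<close> by (rule LeastI_ex)
      have "?K < n"
      proof (rule ccontr)
        assume "\<not> ?K < n"
        hence "q ^ (2 * ?K) \<le> q ^ (2 * n)" using q by (intro power_decreasing) auto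
        thus False using n r by linarith
      qed
      then obtain k where k: "n = Suc k" "?K \<le> k" by (cases n) auto
      have rk: "r < q ^ (2 * k)"
        using not_less_Least [of k "\<lambda>n. q ^ (2 * n) \<le> r"] k by (simp add: n_def)
      obtain u where u: "dist u x < q ^ (2 * n)" "C * q ^ n \<le> \<bar>f u - f x\<bar>"
        using incr [of n] k by auto
      have "real m * r \<le> (real m + 1) * q ^ (2 * k)"
        using rk r by (intro mult_mono) auto
      also have "\<dots> = ((real m + 1) * q ^ n) * q ^ n / q\<^sup>2"
        using q by (simp add: k field_simps power2_eq_square mult_2_right power_add)
      also have "\<dots> \<le> (C * q\<^sup>2) * q ^ n / q\<^sup>2"
        using N1 [of n] k q by (intro divide_right_mono mult_right_mono) (auto simp: field_simps)
      also have "\<dots> = C * q ^ n" using q by simp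
      finally have "real m \<le> 1 / r * \<bar>f x - f u\<bar>"
        using u r by (simp add: field_simps abs_minus_commute)
      hence "ennreal (real m) \<le> ennreal (1 / r) * ennreal \<bar>f x - f u\<bar>"
        using r by (simp add: ennreal_mult' [symmetric] ennreal_leI)
      also have "\<dots> \<le> Lip_scale r f x"
        unfolding Lip_scale_def using u n
        by (intro mult_left_mono SUP_upper) (auto simp: dist_commute)
      finally show ?thesis .
    qed
    moreover have "0 < q ^ (2 * ?K)" using q by simp
    ultimately have "eventually (\<lambda>r. ennreal (real m) \<le> Lip_scale r f x) (at_right 0)"
      unfolding eventually_at_right_field by blast
    thus ?thesis unfolding little_lip_def by (rule Liminf_bounded)
  qed
  hence "of_nat m \<le> little_lip f x" for m
    by (simp add: ennreal_of_nat_eq_real_of_nat)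
  thus ?thesis
    by (metis infinity_ennreal_def ennreal_Ex_less_of_nat not_le top.not_eq_extremum)
qed

section \<open>The layered function\<close>

locale tent_layers =
  fixes A :: "'a::metric_space set" and q c :: real and D :: "nat \<Rightarrow> 'a set"
  assumes closed_A: "closed A" and nonempty_A: "A \<noteq> {}"
    and q: "0 < q" "q < 1" and c: "0 < c" "c \<le> 1"
    and q_small: "2 * (q / (1 - q)) \<le> c / 16"
    and D_subset: "D n \<subseteq> A"
    and D_separated: "pairwise (\<lambda>p p'. q ^ (2 * n) \<le> dist p p') (D n)"
    and D_dense: "x \<in> A \<Longrightarrow> \<exists>p\<in>D n. dist x p < q ^ (2 * n)"
begin

definition layer :: "nat \<Rightarrow> 'a \<Rightarrow> real" where
  "layer n = tent (D n) (q ^ (2 * n))"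

definition f :: "'a \<Rightarrow> real" where
  "f x = (\<Sum>n. q ^ n * layer n x)"

lemma scale_pos: "0 < q ^ (2 * n)"
  using q by simp

lemma norm_layer_le: "norm (q ^ n * layer n x) \<le> q ^ n"
  using q tent_nonneg [of "D n" "q ^ (2 * n)" x] tent_le_1 [OF scale_pos, of "D n" n x]
  by (simp add: layer_def abs_mult mult_left_le)

lemma summable_layers: "summable (\<lambda>n. q ^ n * layer n x)"
  by (rule summable_comparison_test' [of "\<lambda>k. q ^ k" 0, OF _ norm_layer_le]) (use q in auto)

lemma continuous_f: "continuous_on UNIV f"
proof -
  have "uniform_limit UNIV (\<lambda>n x. \<Sum>i<n. q ^ i * layer i x) f sequentially"
    unfolding f_def [abs_def]
    by (rule Weierstrass_m_test [OF norm_layer_le]) (use q in auto)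
  thus ?thesis
    by (rule uniform_limit_theorem [rotated])
       (auto simp: layer_def intro!: always_eventually continuous_intros continuous_on_tent)
qed

lemma f_increment: "f u - f x = (\<Sum>n. q ^ n * (layer n u - layer n x))"
  unfolding f_def by (simp add: suminf_diff summable_layers right_diff_distrib)

lemma little_lip_f:
  assumes x: "x \<in> A"
    and herm: "eventually (\<lambda>r. \<exists>u. c * r < dist u x \<and> dist u x < r) (at_right 0)"
  shows "little_lip f x = \<infinity>"
proof -
  have "(\<lambda>n. (q\<^sup>2) ^ n / 2) \<longlonglongrightarrow> 0 / 2"
    using q by (intro tendsto_intros LIMSEQ_realpow_zero) (auto simp: power_less_one_iff)
  hence "filterlim (\<lambda>n. q ^ (2 * n) / 2) (at_right 0) sequentially"
    using q by (auto simp: filterlim_at power_mult)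
  hence "eventually (\<lambda>n. \<exists>u. c * (q ^ (2 * n) / 2) < dist u x \<and> dist u x < q ^ (2 * n) / 2)
      sequentially"
    using herm by (rule eventually_compose_filterlim [rotated])
  then obtain N where N:
    "\<And>n. N \<le> n \<Longrightarrow> \<exists>u. c * (q ^ (2 * n) / 2) < dist u x \<and> dist u x < q ^ (2 * n) / 2"
    by (auto simp: eventually_sequentially)
  have "\<exists>v. dist v x < q ^ (2 * n) \<and> c / 16 * q ^ n \<le> \<bar>f v - f x\<bar>" if n: "N \<le> n" for n
  proof -
    obtain p where p: "p \<in> D n" "dist x p < q ^ (2 * n)" using D_dense x by blast
    obtain u where u: "c * (q ^ (2 * n) / 2) < dist u x" "dist u x < q ^ (2 * n) / 2"
      using N [OF n] by blast
    obtain v where v: "dist v x < q ^ (2 * n)" "c / 8 \<le> \<bar>layer n v - layer n x\<bar>"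
      unfolding layer_def
      using tent_oscillation [OF scale_pos c D_separated p u] by blast
    have "\<bar>layer k v - layer k x\<bar> \<le> q ^ (2 * n) / q ^ (2 * k)" for k
    proof -
      have "\<bar>layer k v - layer k x\<bar> \<le> dist v x / q ^ (2 * k)"
        unfolding layer_def by (rule tent_lipschitz [OF scale_pos])
      also have "\<dots> \<le> q ^ (2 * n) / q ^ (2 * k)"
        using v scale_pos [of k] by (intro divide_right_mono) auto
      finally show ?thesis .
    qed
    moreover have "\<bar>layer k v - layer k x\<bar> \<le> 1" for k
      unfolding layer_def by (rule tent_increment_le_1 [OF scale_pos])
    ultimately have "(\<bar>layer n v - layer n x\<bar> - 2 * (q / (1 - q))) * q ^ n \<le> \<bar>f v - f x\<bar>"
      unfolding f_increment by (intro lacunary_sum_increment q)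
    moreover have "c / 16 * q ^ n \<le> (\<bar>layer n v - layer n x\<bar> - 2 * (q / (1 - q))) * q ^ n"
      using v q q_small by (intro mult_right_mono) auto
    ultimately show ?thesis using v by (intro exI [of _ v]) auto
  qed
  thus ?thesis
    using q c by (intro little_lip_infinite_if_increments [of q "c / 16" N]) auto
qed

text \<open>All tips lie in \<open>A\<close>, so a layer whose tents have radius at most half the distance from \<open>x\<close> to
  \<open>A\<close> vanishes near \<open>x\<close>.\<close>

lemma local_Lip_f:
  assumes x: "x \<notin> A"
  shows "local_Lip f x < \<infinity>"
proof -
  define \<delta> where "\<delta> = infdist x A"
  have \<delta>: "0 < \<delta>"
    unfolding \<delta>_def by (rule infdist_pos_not_in_closed [OF closed_A nonempty_A x])
  have "q\<^sup>2 < 1" using q by (simp add: power_less_one_iff)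
  then obtain N where N: "(q\<^sup>2) ^ N < \<delta> / 2"
    using real_arch_pow_inv [of "\<delta> / 2" "q\<^sup>2"] \<delta> by auto
  have layer_0: "layer n u = 0" if u: "u \<in> ball x (\<delta> / 2)" and n: "N \<le> n" for u n
  proof -
    have ne: "D n \<noteq> {}" using D_dense nonempty_A by blast
    have "q ^ (2 * n) \<le> q ^ (2 * N)" using q n by (intro power_decreasing) auto
    also have "\<dots> \<le> \<delta> / 2" using N by (simp add: power_mult)
    also have "\<dots> \<le> infdist u (D n)"
      unfolding infdist_notempty [OF ne]
    proof (rule cINF_greatest [OF ne])
      fix p assume "p \<in> D n"
      hence "\<delta> \<le> dist x p" unfolding \<delta>_def using D_subset by (intro infdist_le) auto
      thus "\<delta> / 2 \<le> dist u p" using u dist_triangle [of x p u] by auto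
    qed
    finally show ?thesis using scale_pos [of n] by (simp add: layer_def tent_def)
  qed
  let ?K = "\<Sum>n<N. q ^ n / q ^ (2 * n)"
  show ?thesis
  proof (rule local_Lip_finite_if_lipschitz_near)
    show "0 < \<delta> / 2" using \<delta> by simp
    fix u v assume uv: "u \<in> ball x (\<delta> / 2)" "v \<in> ball x (\<delta> / 2)"
    have "f u - f v = (\<Sum>n<N. q ^ n * (layer n u - layer n v))"
      unfolding f_increment
      by (rule suminf_finite) (simp_all add: layer_0 [OF uv(1)] layer_0 [OF uv(2)])
    also have "\<bar>\<dots>\<bar> \<le> (\<Sum>n<N. q ^ n * (dist u v / q ^ (2 * n)))"
    proof (rule order_trans [OF sum_abs sum_mono])
      fix n
      show "\<bar>q ^ n * (layer n u - layer n v)\<bar> \<le> q ^ n * (dist u v / q ^ (2 * n))"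
        using mult_left_mono [OF tent_lipschitz [OF scale_pos, of "D n" n u v], of "q ^ n"] q
        by (simp add: abs_mult layer_def)
    qed
    also have "\<dots> = ?K * dist u v" by (simp add: sum_distrib_right)
    finally show "\<bar>f u - f v\<bar> \<le> ?K * dist u v" .
  qed
qed

end

lemma Lipschitz_infinity_sets_eq:
  assumes "\<And>x. x \<in> A \<Longrightarrow> little_lip f x = \<infinity>" and "\<And>x. x \<notin> A \<Longrightarrow> local_Lip f x < \<infinity>"
  shows "little_lip_inf f = A" "local_Lip_inf f = A" "big_Lip_inf f = A"
proof -
  have "little_lip f x = \<infinity> \<and> big_Lip f x = \<infinity> \<and> local_Lip f x = \<infinity>" if "x \<in> A" for x
    using assms(1) [OF that] little_lip_le_big_Lip [of f x] big_Lip_le_local_Lip [of f x]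
    by (auto simp: top_unique)
  moreover have "little_lip f x < \<infinity> \<and> big_Lip f x < \<infinity> \<and> local_Lip f x < \<infinity>" if "x \<notin> A" for x
    using assms(2) [OF that] little_lip_le_big_Lip [of f x] big_Lip_le_local_Lip [of f x]
    by (auto intro: le_less_trans)
  ultimately show "little_lip_inf f = A" "local_Lip_inf f = A" "big_Lip_inf f = A"
    unfolding little_lip_inf_def local_Lip_inf_def big_Lip_inf_def by (auto dest: less_imp_neq)
qed

lemma ex_function_with_Lipschitz_infinity_set:
  fixes A :: "'a::metric_space set"
  assumes herm: "hermetic TYPE('a)" and A: "closed A" "\<forall>x\<in>A. \<not> x isolated_in UNIV"
  shows "\<exists>f :: 'a \<Rightarrow> real. continuous_on UNIV f \<and>
           little_lip_inf f = A \<and> local_Lip_inf f = A \<and> big_Lip_inf f = A"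
proof (cases "A = {}")
  case True
  have "local_Lip (\<lambda>_. 0) x < \<infinity>" for x :: 'a
    by (rule local_Lip_finite_if_lipschitz_near [of 1 _ _ 0]) auto
  thus ?thesis
    using Lipschitz_infinity_sets_eq [of A "\<lambda>_. 0"] True
    by (intro exI [of _ "\<lambda>_. 0"]) auto
next
  case False
  obtain c where c: "0 < c" "c \<le> 1" and scales: "\<And>x::'a. \<not> x isolated_in UNIV \<Longrightarrow>
      eventually (\<lambda>r. \<exists>u. c * r < dist u x \<and> dist u x < r) (at_right 0)"
    using hermetic_uniform_constant [OF herm] by blast
  \<comment> \<open>The ratio for which \<open>2 * (q / (1 - q))\<close> is exactly half of the oscillation \<open>c / 8\<close> of a
    layer.\<close>
  define q where "q = c / (c + 32)"
  have q: "0 < q" "q < 1" "2 * (q / (1 - q)) \<le> c / 16"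
    using c by (auto simp: q_def field_simps)
  have "\<exists>D. D \<subseteq> A \<and> pairwise (\<lambda>p p'. q ^ (2 * n) \<le> dist p p') D
      \<and> (\<forall>x\<in>A. \<exists>p\<in>D. dist x p < q ^ (2 * n))" for n
    using maximal_separated_subset [of "q ^ (2 * n)" A] q by (metis zero_less_power)
  then obtain D where D: "\<And>n. D n \<subseteq> A" "\<And>n. pairwise (\<lambda>p p'. q ^ (2 * n) \<le> dist p p') (D n)"
      "\<And>n x. x \<in> A \<Longrightarrow> \<exists>p\<in>D n. dist x p < q ^ (2 * n)"
    by metis
  interpret tent_layers A q c D
    using A False q c D by unfold_locales auto
  have "little_lip f x = \<infinity>" if "x \<in> A" for x
    using little_lip_f [OF that] scales A that by blast
  thus ?thesis
    using continuous_f Lipschitz_infinity_sets_eq [of A f] local_Lip_f by blast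
qed

theorem theorem5p5:
  fixes A :: "'a::metric_space set"
  assumes "hermetic TYPE('a)"
  shows "(closed A \<and> (\<forall>x\<in>A. \<not> x isolated_in UNIV)) \<longleftrightarrow>
         (\<exists>f :: 'a \<Rightarrow> real. continuous_on UNIV f \<and>
            little_lip_inf f = A \<and> local_Lip_inf f = A \<and> big_Lip_inf f = A)"
proof
  assume "closed A \<and> (\<forall>x\<in>A. \<not> x isolated_in UNIV)"
  thus "\<exists>f :: 'a \<Rightarrow> real. continuous_on UNIV f \<and>
      little_lip_inf f = A \<and> local_Lip_inf f = A \<and> big_Lip_inf f = A"
    using ex_function_with_Lipschitz_infinity_set [OF assms] by blast
next
  assume "\<exists>f :: 'a \<Rightarrow> real. continuous_on UNIV f \<and>
      little_lip_inf f = A \<and> local_Lip_inf f = A \<and> big_Lip_inf f = A"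
  then obtain f :: "'a \<Rightarrow> real" where f: "local_Lip_inf f = A" by blast
  have "\<not> x isolated_in UNIV" if "x \<in> A" for x
    using local_Lip_isolated [of x f] that f by (auto simp: local_Lip_inf_def)
  thus "closed A \<and> (\<forall>x\<in>A. \<not> x isolated_in UNIV)"
    using closed_local_Lip_inf [of f] f by simp
qed

end
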